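(* Let $\theta\in(0,1]$, $r=1$, and let $\{Z_n\}_{n\ge0}$ be a GW$^{\,\theta}$-process with parameters $(\theta,1,a_n,c_n)_{n\ge1}$. Suppose $C=\lim_{n\to\infty} C_n<\infty$ and $A_n\to0$. Then the extinction probability is $q=1-C^{-1/\theta}$, and $A_n^{1/\theta}Z_n$ converges almost surely to a random variable $W$ such that $$\mathrm{E}(e^{-\lambda W})=1-(\lambda^{-\theta}+C)^{-1/\theta},\quad \lambda\ge0.$$
   Context: All limits are as $n\to\infty$. Let $\theta\in(0,1]$, $r=1$, and let $(a_n,c_n)_{n\ge1}$ be real sequences with $0<a_n<\infty$, $c_n>0$, $c_n\ge 1-a_n$ for all $n\ge1$. Put $$f_n(s)=1-(a_n(1-s)^{-\theta}+c_n)^{-1/\theta},\quad 0\le s<1,\qquad f_n(1)=1.$$ Each $f_n(s)=\sum_{j\ge0}p_n(j)s^j$ is a probability generating function. The GW$^{\,\theta}$-process with parameters $(\theta,1,a_n,c_n)_{n\ge1}$ is the Galton-Watson process in a varying environment $\{Z_n\}_{n\ge0}$ with $Z_0=1$, $Z_n=\sum_{i=1}^{Z_{n-1}}X_{n,i}$, where $\{X_{n,i}\}_{n,i\ge1}$ are independent and $\mathrm{P}(X_{n,i}=j)=p_n(j)$. Thus $\mathrm{E}(s^{Z_n})=f_1\circ\cdots\circ f_n(s)$. The extinction probability is $q=\lim \mathrm{P}(Z_n=0)$. Notation: $A_0=1$, $A_n=\prod_{i=1}^n a_i$, $C_n=\sum_{i=1}^n A_{i-1}c_i$, $C=\lim C_n\in(0,\infty]$.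 Conventions: $0^{-\theta}=\infty$, $\infty^{-1/\theta}=0$. *)

theory Defs
  imports "HOL-Probability.Probability"
begin

definition pgf :: "nat pmf \<Rightarrow> real \<Rightarrow> real" where
  "pgf p s = (\<Sum>j. pmf p j * s ^ j)"

text \<open>Generations and individuals are numbered from 1; \<open>X n i\<close> is the number of children
  of the \<open>i\<close>-th individual of generation \<open>n - 1\<close>.\<close>

primrec gw_size :: "(nat \<Rightarrow> nat \<Rightarrow> 'a \<Rightarrow> nat) \<Rightarrow> nat \<Rightarrow> 'a \<Rightarrow> nat" where
  "gw_size X 0 \<omega> = 1"
| "gw_size X (Suc n) \<omega> = (\<Sum>i = 1..gw_size X n \<omega>. X (Suc n) i \<omega>)"

locale galton_watson_varying = prob_space M
  for M :: "'a measure" +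
  fixes X :: "nat \<Rightarrow> nat \<Rightarrow> 'a \<Rightarrow> nat"
    and p :: "nat \<Rightarrow> nat pmf"
  assumes indep_offspring:
      "indep_vars (\<lambda>_. count_space UNIV) (\<lambda>(n, i). X n i) ({1..} \<times> {1..})"
    and distr_offspring:
      "\<And>n i. 1 \<le> n \<Longrightarrow> 1 \<le> i \<Longrightarrow> distr M (count_space UNIV) (X n i) = measure_pmf (p n)"

text \<open>The case distinction is needed because \<open>0 powr x = 0\<close>, whereas
  \<open>0\<close> to the power \<open>-\<theta>\<close> is to be read as infinity.\<close>

definition theta_pgf :: "real \<Rightarrow> real \<Rightarrow> real \<Rightarrow> real \<Rightarrow> real" where
  "theta_pgf \<theta> a c s =
     (if s = 1 then 1 else 1 - (a * (1 - s) powr (-\<theta>) + c) powr (-1 / \<theta>))"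

text \<open>The processes with parameters \<open>(\<theta>, r, a\<^sub>n, c\<^sub>n)\<close> for \<open>r = 1\<close>. The values of
  \<open>a\<close>, \<open>c\<close>, \<open>p\<close> and \<open>X\<close> at index 0 are irrelevant.\<close>

locale gw_theta_process = galton_watson_varying M X p
  for M :: "'a measure" and X :: "nat \<Rightarrow> nat \<Rightarrow> 'a \<Rightarrow> nat" and p :: "nat \<Rightarrow> nat pmf" +
  fixes \<theta> :: real and a c :: "nat \<Rightarrow> real"
  assumes theta_range: "0 < \<theta>" "\<theta> \<le> 1"
    and a_pos: "\<And>n. 1 \<le> n \<Longrightarrow> 0 < a n"
    and c_pos: "\<And>n. 1 \<le> n \<Longrightarrow> 0 < c n"
    and c_ge: "\<And>n. 1 \<le> n \<Longrightarrow> 1 - a n \<le> c n"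
    and pgf_offspring:
      "\<And>n s. 1 \<le> n \<Longrightarrow> 0 \<le> s \<Longrightarrow> s \<le> 1 \<Longrightarrow> pgf (p n) s = theta_pgf \<theta> (a n) (c n) s"

definition env_A :: "(nat \<Rightarrow> real) \<Rightarrow> nat \<Rightarrow> real" where
  "env_A a n = (\<Prod>i = 1..n. a i)"

definition env_C :: "(nat \<Rightarrow> real) \<Rightarrow> (nat \<Rightarrow> real) \<Rightarrow> nat \<Rightarrow> real" where
  "env_C a c n = (\<Sum>i = 1..n. env_A a (i - 1) * c i)"

end

theory Submission
  imports Defs
begin

text \<open>Iterating the \<open>f\<^sub>n\<close> gives \<open>E s\<^bsup>Z\<^esup> = 1 - (A\<^sub>n (1 - s) powr (-\<theta>) + C\<^sub>n) powr (-1 / \<theta>)\<close> for \<open>Z = Z\<^sub>n\<close>;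
  \<open>s = 0\<close> yields the extinction probability, and \<open>s = exp (-\<lambda> A\<^sub>n powr (1 / \<theta>))\<close> the limit of the
  Laplace transforms. Almost sure convergence does not follow from convergence of transforms; it
  comes from the powers \<open>s\<^sub>n\<close> to the \<open>Z\<^sub>n\<close> with \<open>f\<^sub>n(s\<^sub>n) = s\<^sub>n\<^sub>-\<^sub>1\<close>, which form a martingale with
  values in \<open>[0,1]\<close>. Its logarithm is asymptotically \<open>-A\<^sub>n powr (1 / \<theta>) Z\<^sub>n\<close>, and the limit of the
  martingale is almost surely positive because the limiting Laplace transform tends to 1 at 0.\<close>

section \<open>Bounded martingales\<close>

text \<open>The event splits by the first index \<open>k\<close> at which the deviation reaches
  \<open>\<epsilon>\<close>, and increments after \<open>k\<close> are orthogonal to everything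
  known at \<open>k\<close>. The martingale property is phrased by testing against bounded
  \<open>F n\<close>-measurable functions, the form in which the branching property is proved
  below.\<close>

lemma (in prob_space) martingale_maximal_inequality:
  fixes V :: "nat \<Rightarrow> 'a \<Rightarrow> real"
  assumes sub: "\<And>n. subalgebra M (F n)"
    and mono: "\<And>n. subalgebra (F (Suc n)) (F n)"
    and adapted: "\<And>n. V n \<in> borel_measurable (F n)"
    and bounded: "\<And>n \<omega>. \<omega> \<in> space M \<Longrightarrow> \<bar>V n \<omega>\<bar> \<le> B"
    and martingale: "\<And>n h. h \<in> borel_measurable (F n) \<Longrightarrow> (\<exists>K. \<forall>\<omega>\<in>space M. \<bar>h \<omega>\<bar> \<le> K) \<Longrightarrow>
        expectation (\<lambda>\<omega>. h \<omega> * V (Suc n) \<omega>) = expectation (\<lambda>\<omega>. h \<omega> * V n \<omega>)"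
    and "0 < \<epsilon>" and "m \<le> N"
  shows "\<epsilon>\<^sup>2 * prob {\<omega> \<in> space M. \<exists>k\<in>{m..N}. \<epsilon> \<le> \<bar>V k \<omega> - V m \<omega>\<bar>}
    \<le> expectation (\<lambda>\<omega>. (V N \<omega>)\<^sup>2) - expectation (\<lambda>\<omega>. (V m \<omega>)\<^sup>2)"
proof -
  have sub_le: "subalgebra (F n) (F k)" if "k \<le> n" for k n
    using that
  proof (induction n rule: dec_induct)
    case base
    then show ?case by (simp add: subalgebra_def)
  next
    case (step n)
    then show ?case using mono[of n] by (auto simp: subalgebra_def)
  qed
  have meas[measurable]: "V n \<in> borel_measurable M" for n
    using measurable_from_subalg[OF sub adapted] .
  have measF: "V k \<in> borel_measurable (F n)" if "k \<le> n" for k n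
    using measurable_from_subalg[OF sub_le[OF that] adapted] .
  have space_F: "space (F n) = space M" for n
    using sub[of n] by (simp add: subalgebra_def)
  have intg: "integrable M h" if "h \<in> borel_measurable M" "\<And>\<omega>. \<omega> \<in> space M \<Longrightarrow> \<bar>h \<omega>\<bar> \<le> K"
    for h :: "'a \<Rightarrow> real" and K
    using that by (intro integrable_const_bound[where B=K]) auto
  \<comment> \<open>The one-step identity iterates because a test function measurable at
    \<open>k\<close> stays measurable at all later indices.\<close>
  have mart: "expectation (\<lambda>\<omega>. h \<omega> * V n \<omega>) = expectation (\<lambda>\<omega>. h \<omega> * V k \<omega>)"
    if "k \<le> n" "h \<in> borel_measurable (F k)" "\<And>\<omega>. \<omega> \<in> space M \<Longrightarrow> \<bar>h \<omega>\<bar> \<le> K" for h k n K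
    using that(1)
  proof (induction n rule: dec_induct)
    case (step n)
    have "h \<in> borel_measurable (F n)"
      using measurable_from_subalg[OF sub_le that(2)] step by simp
    then show ?case using martingale[of h n] that(3) step by auto
  qed simp
  have B: "\<bar>V k \<omega> - V n \<omega>\<bar> \<le> 2 * B" if "\<omega> \<in> space M" for k n \<omega>
    using bounded[OF that, of k] bounded[OF that, of n] by linarith
  have B0: "0 \<le> B"
    using bounded[of _ 0] not_empty by (meson abs_ge_zero all_not_in_conv order_trans)
  have B2: "(V k \<omega> - V n \<omega>)\<^sup>2 \<le> (2 * B)\<^sup>2" if "\<omega> \<in> space M" for k n \<omega>
    using B[OF that, of k n] B0 by (intro power2_le_iff_abs_le[THEN iffD2]) auto
  have decomp: "expectation (\<lambda>\<omega>. h \<omega> * (V N \<omega> - V m \<omega>)\<^sup>2)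
      = expectation (\<lambda>\<omega>. h \<omega> * (V k \<omega> - V m \<omega>)\<^sup>2) + expectation (\<lambda>\<omega>. h \<omega> * (V N \<omega> - V k \<omega>)\<^sup>2)"
    if k: "m \<le> k" "k \<le> N" and h: "h \<in> borel_measurable (F k)"
      "\<And>\<omega>. \<omega> \<in> space M \<Longrightarrow> \<bar>h \<omega>\<bar> \<le> 1" for h k
  proof -
    have hM[measurable]: "h \<in> borel_measurable M"
      using measurable_from_subalg[OF sub h(1)] .
    \<comment> \<open>\<open>g\<close> is the factor of \<open>V N - V k\<close> in the cross term
      when the square of \<open>(V k - V m) + (V N - V k)\<close> is expanded. It is bounded and
      \<open>F k\<close>-measurable, so the cross term integrates to 0.\<close>
    define g where "g = (\<lambda>\<omega>. 2 * h \<omega> * (V k \<omega> - V m \<omega>))"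
    have gF: "g \<in> borel_measurable (F k)"
      unfolding g_def using h measF[OF k(1)] adapted[of k] by measurable
    have gM[measurable]: "g \<in> borel_measurable M"
      using measurable_from_subalg[OF sub gF] .
    have gb: "\<bar>g \<omega>\<bar> \<le> 2 * (2 * B)" if "\<omega> \<in> space M" for \<omega>
      using mult_mono[OF h(2)[OF that] B[OF that, of k m]] by (simp add: g_def abs_mult)
    have i1: "integrable M (\<lambda>\<omega>. g \<omega> * V n \<omega>)" for n
      using mult_mono[OF gb bounded[of _ n]] B0
      by (intro intg[of _ "2 * (2 * B) * B"]) (auto simp: abs_mult)
    have i2: "integrable M (\<lambda>\<omega>. h \<omega> * (V i \<omega> - V j \<omega>)\<^sup>2)" for i j
      using mult_mono[OF h(2) B2[of _ i j]] B0
      by (intro intg[of _ "1 * (2 * B)\<^sup>2"]) (auto simp: abs_mult)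
    have "expectation (\<lambda>\<omega>. h \<omega> * (V N \<omega> - V m \<omega>)\<^sup>2) = expectation (\<lambda>\<omega>.
        (h \<omega> * (V k \<omega> - V m \<omega>)\<^sup>2 + h \<omega> * (V N \<omega> - V k \<omega>)\<^sup>2) + (g \<omega> * V N \<omega> - g \<omega> * V k \<omega>))"
      by (intro Bochner_Integration.integral_cong refl)
         (simp add: g_def power2_eq_square algebra_simps)
    also have "\<dots> = expectation (\<lambda>\<omega>. h \<omega> * (V k \<omega> - V m \<omega>)\<^sup>2)
        + expectation (\<lambda>\<omega>. h \<omega> * (V N \<omega> - V k \<omega>)\<^sup>2)
        + (expectation (\<lambda>\<omega>. g \<omega> * V N \<omega>) - expectation (\<lambda>\<omega>. g \<omega> * V k \<omega>))"
      using i1 i2 by simp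
    finally show ?thesis using mart[OF k(2) gF gb] by simp
  qed
  \<comment> \<open>\<open>T k\<close> says that \<open>k\<close> is the first index from
    \<open>m\<close> on with deviation at least \<open>\<epsilon>\<close>. It involves no
    \<open>V j\<close> with \<open>j > k\<close> and hence lies in \<open>F k\<close>, so its
    indicator can serve as \<open>h\<close> in \<open>decomp\<close>.\<close>
  define T where
    "T k = {\<omega> \<in> space M. \<epsilon> \<le> \<bar>V k \<omega> - V m \<omega>\<bar> \<and> (\<forall>j\<in>{m..<k}. \<bar>V j \<omega> - V m \<omega>\<bar> < \<epsilon>)}" for k
  have TF: "T k \<in> sets (F k)" if "m \<le> k" for k
  proof -
    have [measurable]: "V k \<in> borel_measurable (F k)" "V m \<in> borel_measurable (F k)"
      "\<And>j. j \<in> {m..<k} \<Longrightarrow> V j \<in> borel_measurable (F k)"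
      using measF that by auto
    show ?thesis unfolding T_def space_F[of k, symmetric] by measurable
  qed
  have T[measurable]: "T k \<in> sets M" for k unfolding T_def by measurable
  have iT: "integrable M (\<lambda>\<omega>. indicator (T k) \<omega> * (V i \<omega> - V j \<omega>)\<^sup>2)" for k i j
    using B2[of _ i j] by (intro intg[of _ "(2 * B)\<^sup>2"]) (auto simp: indicator_def)
  have T_bound: "\<epsilon>\<^sup>2 * prob (T k) \<le> expectation (\<lambda>\<omega>. indicator (T k) \<omega> * (V N \<omega> - V m \<omega>)\<^sup>2)"
    if k: "k \<in> {m..N}" for k
  proof -
    have "\<epsilon>\<^sup>2 * prob (T k) = expectation (\<lambda>\<omega>. \<epsilon>\<^sup>2 * indicator (T k) \<omega>)"
      by simp
    also have "\<dots> \<le> expectation (\<lambda>\<omega>. indicator (T k) \<omega> * (V k \<omega> - V m \<omega>)\<^sup>2)"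
    proof (rule integral_mono[OF _ iT])
      fix \<omega> assume "\<omega> \<in> space M"
      have "\<epsilon>\<^sup>2 \<le> (V k \<omega> - V m \<omega>)\<^sup>2" if "\<epsilon> \<le> \<bar>V k \<omega> - V m \<omega>\<bar>"
        using power_mono[OF that, of 2] \<open>0 < \<epsilon>\<close> by simp
      then show "\<epsilon>\<^sup>2 * indicator (T k) \<omega> \<le> indicator (T k) \<omega> * (V k \<omega> - V m \<omega>)\<^sup>2"
        by (auto simp: indicator_def T_def)
    qed (simp add: integrable_real_indicator less_top[symmetric])
    also have "\<dots> \<le> expectation (\<lambda>\<omega>. indicator (T k) \<omega> * (V N \<omega> - V m \<omega>)\<^sup>2)"
    proof -
      have "0 \<le> expectation (\<lambda>\<omega>. indicator (T k) \<omega> * (V N \<omega> - V k \<omega>)\<^sup>2)"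
        by (intro Bochner_Integration.integral_nonneg) simp
      then show ?thesis
        using decomp[of k "indicator (T k)"] k TF[of k] by auto
    qed
    finally show ?thesis .
  qed
  have union: "{\<omega> \<in> space M. \<exists>k\<in>{m..N}. \<epsilon> \<le> \<bar>V k \<omega> - V m \<omega>\<bar>} = (\<Union>k\<in>{m..N}. T k)" (is "?U = _")
  proof (intro equalityI subsetI)
    fix \<omega> assume "\<omega> \<in> ?U"
    then obtain k where k: "\<omega> \<in> space M" "k \<in> {m..N}" "\<epsilon> \<le> \<bar>V k \<omega> - V m \<omega>\<bar>" by auto
    define k' where "k' = (LEAST k. m \<le> k \<and> \<epsilon> \<le> \<bar>V k \<omega> - V m \<omega>\<bar>)"
    have "m \<le> k' \<and> \<epsilon> \<le> \<bar>V k' \<omega> - V m \<omega>\<bar>"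
      unfolding k'_def by (rule LeastI[where k=k]) (use k in simp)
    moreover have "k' \<le> k"
      unfolding k'_def by (rule Least_le) (use k in simp)
    moreover have "\<bar>V j \<omega> - V m \<omega>\<bar> < \<epsilon>" if "j \<in> {m..<k'}" for j
      using that not_less_Least[of j "\<lambda>k. m \<le> k \<and> \<epsilon> \<le> \<bar>V k \<omega> - V m \<omega>\<bar>"] by (auto simp: k'_def)
    ultimately show "\<omega> \<in> (\<Union>k\<in>{m..N}. T k)"
      using k by (auto simp: T_def intro!: bexI[of _ k'])
  qed (auto simp: T_def)
  have disj: "disjoint_family_on T {m..N}"
    unfolding disjoint_family_on_def
  proof (intro ballI impI)
    fix i j assume "i \<in> {m..N}" "j \<in> {m..N}" "i \<noteq> j"
    then show "T i \<inter> T j = {}"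
      by (cases "i < j") (force simp: T_def)+
  qed
  have "\<epsilon>\<^sup>2 * prob ?U = (\<Sum>k\<in>{m..N}. \<epsilon>\<^sup>2 * prob (T k))"
    unfolding union using disj
    by (subst finite_measure_finite_Union) (auto simp: sum_distrib_left)
  also have "\<dots> \<le> (\<Sum>k\<in>{m..N}. expectation (\<lambda>\<omega>. indicator (T k) \<omega> * (V N \<omega> - V m \<omega>)\<^sup>2))"
    by (intro sum_mono T_bound)
  also have "\<dots> = expectation (\<lambda>\<omega>. (\<Sum>k\<in>{m..N}. indicator (T k) \<omega> * (V N \<omega> - V m \<omega>)\<^sup>2))"
    by (rule Bochner_Integration.integral_sum[symmetric]) (rule iT)
  also have "\<dots> \<le> expectation (\<lambda>\<omega>. (V N \<omega> - V m \<omega>)\<^sup>2)"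
  proof (rule integral_mono)
    show "integrable M (\<lambda>\<omega>. (V N \<omega> - V m \<omega>)\<^sup>2)"
      using B2 by (intro intg[of _ "(2 * B)\<^sup>2"]) auto
    fix \<omega>
    have "(\<Sum>k\<in>{m..N}. indicator (T k) \<omega>) = (indicator (\<Union>k\<in>{m..N}. T k) \<omega> :: real)"
      by (rule indicator_UN_disjoint[OF _ disj, symmetric]) simp
    also have "\<dots> \<le> 1" by (simp add: indicator_def)
    finally have "(\<Sum>k\<in>{m..N}. indicator (T k) \<omega>) * (V N \<omega> - V m \<omega>)\<^sup>2 \<le> 1 * (V N \<omega> - V m \<omega>)\<^sup>2"
      by (rule mult_right_mono) simp
    then show "(\<Sum>k\<in>{m..N}. indicator (T k) \<omega> * (V N \<omega> - V m \<omega>)\<^sup>2) \<le> (V N \<omega> - V m \<omega>)\<^sup>2"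
      by (simp only: sum_distrib_right mult_1)
  qed (intro Bochner_Integration.integrable_sum iT)
  \<comment> \<open>Testing with \<open>V m\<close> itself gives
    \<open>E (V m * V N) = E (V m * V m)\<close>.\<close>
  also have "\<dots> = expectation (\<lambda>\<omega>. (V N \<omega>)\<^sup>2) - expectation (\<lambda>\<omega>. (V m \<omega>)\<^sup>2)"
  proof -
    have i: "integrable M (\<lambda>\<omega>. V i \<omega> * V j \<omega>)" for i j
      using mult_mono[OF bounded[of _ i] bounded[of _ j]] B0
      by (intro intg[of _ "B * B"]) (auto simp: abs_mult)
    have "expectation (\<lambda>\<omega>. (V N \<omega> - V m \<omega>)\<^sup>2) = expectation (\<lambda>\<omega>.
        V N \<omega> * V N \<omega> - V m \<omega> * V N \<omega> - (V m \<omega> * V N \<omega> - V m \<omega> * V m \<omega>))"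
      by (intro Bochner_Integration.integral_cong refl)
         (simp add: power2_eq_square algebra_simps)
    then show ?thesis
      using i mart[OF \<open>m \<le> N\<close> adapted bounded] by (simp add: power2_eq_square mult.commute)
  qed
  finally show ?thesis .
qed

text \<open>Second moments increase and are bounded, hence converge. The maximal inequality turns
  this into vanishing probabilities of an oscillation by \<open>\<epsilon>\<close> after time
  \<open>m\<close>, so almost every path is Cauchy.\<close>

lemma (in prob_space) bounded_martingale_AE_convergent:
  fixes V :: "nat \<Rightarrow> 'a \<Rightarrow> real"
  assumes sub: "\<And>n. subalgebra M (F n)"
    and mono: "\<And>n. subalgebra (F (Suc n)) (F n)"
    and adapted: "\<And>n. V n \<in> borel_measurable (F n)"
    and bounded: "\<And>n \<omega>. \<omega> \<in> space M \<Longrightarrow> \<bar>V n \<omega>\<bar> \<le> B"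
    and martingale: "\<And>n h. h \<in> borel_measurable (F n) \<Longrightarrow> (\<exists>K. \<forall>\<omega>\<in>space M. \<bar>h \<omega>\<bar> \<le> K) \<Longrightarrow>
        expectation (\<lambda>\<omega>. h \<omega> * V (Suc n) \<omega>) = expectation (\<lambda>\<omega>. h \<omega> * V n \<omega>)"
  shows "AE \<omega> in M. convergent (\<lambda>n. V n \<omega>)"
proof -
  have [measurable]: "V n \<in> borel_measurable M" for n
    using measurable_from_subalg[OF sub adapted] .
  define S where "S n = expectation (\<lambda>\<omega>. (V n \<omega>)\<^sup>2)" for n
  have maximal: "\<epsilon>\<^sup>2 * prob {\<omega> \<in> space M. \<exists>k\<in>{m..N}. \<epsilon> \<le> \<bar>V k \<omega> - V m \<omega>\<bar>} \<le> S N - S m"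
    if "0 < \<epsilon>" "m \<le> N" for \<epsilon> m N
    unfolding S_def by (rule martingale_maximal_inequality[where F=F and B=B, OF assms that])
  \<comment> \<open>With \<open>\<epsilon> = 1\<close>, the left side of the maximal inequality is a
    probability and thus nonnegative.\<close>
  have "S m \<le> S n" if "m \<le> n" for m n
    using order_trans[OF measure_nonneg maximal[of 1 m n, simplified]] that by simp
  then have "incseq S" by (simp add: incseq_def)
  moreover have "S n \<le> B\<^sup>2" for n
    unfolding S_def
  proof (rule integral_le_const)
    show "AE \<omega> in M. (V n \<omega>)\<^sup>2 \<le> B\<^sup>2"
      using bounded[of _ n] by (intro AE_I2) (metis abs_le_square_iff abs_ge_self order_trans)
    show "integrable M (\<lambda>\<omega>. (V n \<omega>)\<^sup>2)"
      using \<open>AE \<omega> in M. (V n \<omega>)\<^sup>2 \<le> B\<^sup>2\<close>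
      by (intro integrable_const_bound[where B="B\<^sup>2"]) auto
  qed
  ultimately obtain L where L: "S \<longlonglongrightarrow> L" "\<And>n. S n \<le> L"
    using incseq_convergent[of S] by metis
  have null: "AE \<omega> in M. \<exists>m. \<forall>k\<ge>m. \<bar>V k \<omega> - V m \<omega>\<bar> < \<epsilon>" if \<epsilon>: "0 < \<epsilon>" for \<epsilon>
  proof -
    \<comment> \<open>\<open>D m N\<close> has a finite horizon, as the maximal inequality requires.
      Its bound \<open>L - S m\<close> is free of \<open>N\<close> and passes to the increasing
      union \<open>E m\<close>.\<close>
    define D where "D m N = {\<omega> \<in> space M. \<exists>k\<in>{m..N}. \<epsilon> \<le> \<bar>V k \<omega> - V m \<omega>\<bar>}" for m N
    define E where "E m = {\<omega> \<in> space M. \<exists>k\<ge>m. \<epsilon> \<le> \<bar>V k \<omega> - V m \<omega>\<bar>}" for m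
    have [measurable]: "D m N \<in> sets M" "E m \<in> sets M" for m N
      by (simp_all add: D_def E_def)
    have "\<epsilon>\<^sup>2 * prob (E m) \<le> L - S m" for m
    proof -
      have "(\<lambda>N. prob (D m N)) \<longlonglongrightarrow> prob (\<Union>N. D m N)"
        by (intro finite_Lim_measure_incseq) (auto simp: incseq_def D_def)
      also have "(\<Union>N. D m N) = E m" by (fastforce simp: D_def E_def)
      finally have lim: "(\<lambda>N. \<epsilon>\<^sup>2 * prob (D m N)) \<longlonglongrightarrow> \<epsilon>\<^sup>2 * prob (E m)"
        by (intro tendsto_mult tendsto_const)
      show ?thesis
      proof (rule LIMSEQ_le_const2[OF lim], intro exI[of _ m] allI impI)
        fix n assume "m \<le> n"
        then show "\<epsilon>\<^sup>2 * prob (D m n) \<le> L - S m"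
          using maximal[OF \<epsilon>, of m n] L(2)[of n] by (simp add: D_def)
      qed
    qed
    moreover have "prob (\<Inter>m. E m) \<le> prob (E m)" for m
      by (intro finite_measure_mono) auto
    ultimately have "\<epsilon>\<^sup>2 * prob (\<Inter>m. E m) \<le> L - S m" for m
      by (meson mult_left_mono order_trans zero_le_power2)
    moreover have "(\<lambda>m. L - S m) \<longlonglongrightarrow> L - L"
      by (intro tendsto_intros L)
    ultimately have "\<epsilon>\<^sup>2 * prob (\<Inter>m. E m) \<le> 0"
      by (intro LIMSEQ_le_const[of "\<lambda>m. L - S m" 0]) auto
    then have "prob (\<Inter>m. E m) = 0"
      using \<epsilon> by (simp add: mult_le_0_iff measure_le_0_iff)
    then have "AE \<omega> in M. \<omega> \<notin> (\<Inter>m. E m)"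
      by (intro AE_not_in) (auto simp: null_sets_def emeasure_eq_measure)
    then show ?thesis
      using AE_space
    proof eventually_elim
      case (elim \<omega>)
      then obtain m where "\<omega> \<notin> E m" by blast
      then have "\<not> (\<exists>k\<ge>m. \<epsilon> \<le> \<bar>V k \<omega> - V m \<omega>\<bar>)"
        using elim by (simp add: E_def)
      then show ?case by (meson not_le)
    qed
  qed
  \<comment> \<open>Restricting \<open>\<epsilon>\<close> to a sequence tending to 0 leaves
    countably many null sets to unite.\<close>
  have "AE \<omega> in M. \<forall>i::nat. \<exists>m. \<forall>k\<ge>m. \<bar>V k \<omega> - V m \<omega>\<bar> < 1 / real (Suc i)"
    by (intro AE_all_countable[THEN iffD2] allI null) simp
  then show ?thesis
  proof eventually_elim
    case (elim \<omega>)
    have "Cauchy (\<lambda>n. V n \<omega>)"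
    proof (rule metric_CauchyI)
      fix e :: real assume "0 < e"
      then obtain i where "1 / real (Suc i) < e / 2"
        using reals_Archimedean[of "e / 2"] by (auto simp: inverse_eq_divide)
      moreover obtain m where "\<forall>k\<ge>m. \<bar>V k \<omega> - V m \<omega>\<bar> < 1 / real (Suc i)"
        using elim by blast
      ultimately have *: "\<forall>k\<ge>m. \<bar>V k \<omega> - V m \<omega>\<bar> < e / 2" by fastforce
      have "\<bar>V k \<omega> - V n \<omega>\<bar> < e" if "m \<le> k" "m \<le> n" for k n
        using *[rule_format, OF that(1)] *[rule_format, OF that(2)] by linarith
      then show "\<exists>m. \<forall>k\<ge>m. \<forall>n\<ge>m. dist (V k \<omega>) (V n \<omega>) < e"
        by (auto simp: dist_real_def)
    qed
    then show ?case by (simp add: Cauchy_convergent_iff)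
  qed
qed

section \<open>Branching in a varying environment\<close>

text \<open>Independence concerns only the generated sigma-algebras, and those of \<open>h\<close>
  and \<open>g (Z \<omega>)\<close> lie inside those of \<open>Y\<close> and \<open>Z\<close>. Thus
  \<open>h\<close> enters through its measurability alone, without being factored through
  \<open>Y\<close>.\<close>

lemma (in prob_space) indep_var_vimage_algebra:
  assumes indep: "indep_var S Y T Z"
    and h: "h \<in> measurable (vimage_algebra (space M) Y S) N"
    and g: "g \<in> measurable T L"
  shows "indep_var N h L (\<lambda>\<omega>. g (Z \<omega>))"
proof -
  let ?SY = "sigma_sets (space M) {Y -` A \<inter> space M | A. A \<in> sets S}"
  let ?SZ = "sigma_sets (space M) {Z -` A \<inter> space M | A. A \<in> sets T}"
  have Y: "Y \<in> measurable M S" and Z: "Z \<in> measurable M T" and ind: "indep_set ?SY ?SZ"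
    using indep unfolding indep_var_eq by auto
  have "sets (vimage_algebra (space M) Y S) \<subseteq> sets M"
    by (rule sets_image_in_sets[OF refl Y])
  then have hM: "h \<in> measurable M N"
    using measurable_mono[OF order_refl refl, of "vimage_algebra (space M) Y S" M N] h by auto
  have gZ: "(\<lambda>\<omega>. g (Z \<omega>)) \<in> measurable M L"
    using measurable_compose[OF Z g] .
  have "h -` A \<inter> space M \<in> ?SY" if "A \<in> sets N" for A
    using measurable_sets[OF h that] by (simp add: sets_vimage_algebra)
  then have 1: "sigma_sets (space M) {h -` A \<inter> space M | A. A \<in> sets N} \<subseteq> ?SY"
    by (intro sigma_sets_mono) auto
  have "(\<lambda>\<omega>. g (Z \<omega>)) -` A \<inter> space M \<in> ?SZ" if "A \<in> sets L" for A
  proof -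
    have "(\<lambda>\<omega>. g (Z \<omega>)) -` A \<inter> space M = Z -` (g -` A \<inter> space T) \<inter> space M"
      using measurable_space[OF Z] by auto
    then show ?thesis using measurable_sets[OF g that] by blast
  qed
  then have 2: "sigma_sets (space M) {(\<lambda>\<omega>. g (Z \<omega>)) -` A \<inter> space M | A. A \<in> sets L} \<subseteq> ?SZ"
    by (intro sigma_sets_mono) auto
  show ?thesis
    unfolding indep_var_eq using hM gZ ind 1 2
    unfolding indep_sets2_eq by blast
qed

text \<open>Countable additivity over the level sets of \<open>N\<close>. Applied with
  \<open>N\<close> a generation size, it replaces a sum of random length by sums of fixed
  length.\<close>

lemma integral_eq_if_slices_eq:
  fixes f g :: "'a \<Rightarrow> real" and N :: "'a \<Rightarrow> nat"
  assumes f: "integrable M f" and g: "integrable M g"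
    and N[measurable]: "N \<in> measurable M (count_space UNIV)"
    and eq: "\<And>z. (\<integral>\<omega>. indicator {\<omega>. N \<omega> = z} \<omega> * f \<omega> \<partial>M) = (\<integral>\<omega>. indicator {\<omega>. N \<omega> = z} \<omega> * g \<omega> \<partial>M)"
  shows "(\<integral>\<omega>. f \<omega> \<partial>M) = (\<integral>\<omega>. g \<omega> \<partial>M)"
proof -
  define A where "A z = {\<omega> \<in> space M. N \<omega> = z}" for z
  have A: "A z \<in> sets M" for z unfolding A_def by measurable
  have U: "(\<Union>z. A z) = space M" by (auto simp: A_def)
  have slice: "(LINT \<omega>:A z|M. h \<omega>) = (\<integral>\<omega>. indicator {\<omega>. N \<omega> = z} \<omega> * h \<omega> \<partial>M)"
    for z and h :: "'a \<Rightarrow> real"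
    unfolding set_lebesgue_integral_def
    by (intro Bochner_Integration.integral_cong refl) (auto simp: A_def indicator_def)
  have sum: "(\<integral>\<omega>. h \<omega> \<partial>M) = (\<Sum>z. LINT \<omega>:A z|M. h \<omega>)" if "integrable M h" for h :: "'a \<Rightarrow> real"
  proof -
    have "(LINT \<omega>:(\<Union>z. A z)|M. h \<omega>) = (\<Sum>z. LINT \<omega>:A z|M. h \<omega>)"
    proof (rule lebesgue_integral_countable_add[OF A])
      show "set_integrable M (\<Union>z. A z) h"
        unfolding U set_integrable_def using integrable_mult_indicator[OF sets.top that] .
    qed (auto simp: A_def)
    then show ?thesis by (simp add: U set_integral_space[OF that])
  qed
  show ?thesis using sum[OF f] sum[OF g] by (simp add: slice eq)
qed

section \<open>Generating functions as expectations\<close>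

lemma integral_measure_pmf_power:
  assumes "0 \<le> s" "s \<le> 1"
  shows "(\<integral>j. s ^ j \<partial>measure_pmf p) = pgf p s"
proof -
  have "integrable (measure_pmf p) (\<lambda>j. s ^ j)"
    using assms by (intro measure_pmf.integrable_const_bound[where B=1]) (auto simp: power_le_one)
  then have "integrable (count_space UNIV) (\<lambda>j. pmf p j * s ^ j)"
    by (simp add: measure_pmf_eq_density integrable_density pmf_nonneg)
  then show ?thesis
    by (simp add: measure_pmf_eq_density integral_density pmf_nonneg pgf_def integral_count_space_nat)
qed

lemma pgf_bounds:
  assumes "0 \<le> s" "s \<le> 1"
  shows "0 \<le> pgf p s" "pgf p s \<le> 1"
proof -
  have "integrable (measure_pmf p) (\<lambda>j. s ^ j)"
    using assms by (intro measure_pmf.integrable_const_bound[where B=1]) (auto simp: power_le_one)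
  then show "pgf p s \<le> 1"
    unfolding integral_measure_pmf_power[OF assms, symmetric]
    by (intro measure_pmf.integral_le_const) (use assms in \<open>auto simp: power_le_one\<close>)
  show "0 \<le> pgf p s"
    unfolding integral_measure_pmf_power[OF assms, symmetric]
    using assms by (intro Bochner_Integration.integral_nonneg) auto
qed

section \<open>The offspring filtration and the branching property\<close>

context galton_watson_varying
begin

text \<open>The sigma-algebra generated by the first \<open>n\<close> generations, as a pullback
  along the whole family at once. In this form the independence of disjoint index blocks given by
  \<open>indep_var_restrict\<close> applies to it directly.\<close>

definition offspring_algebra :: "nat \<Rightarrow> 'a measure" where
  "offspring_algebra n = vimage_algebra (space M)
     (\<lambda>\<omega>. restrict (\<lambda>k. case_prod X k \<omega>) ({1..n} \<times> {1..})) (PiM ({1..n} \<times> {1..}) (\<lambda>_. count_space UNIV))"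

lemma space_offspring_algebra [simp]: "space (offspring_algebra n) = space M"
  by (simp add: offspring_algebra_def)

lemma measurable_offspring_algebra:
  assumes "1 \<le> m" "m \<le> n" "1 \<le> i"
  shows "X m i \<in> measurable (offspring_algebra n) (count_space UNIV)"
proof -
  have Y: "(\<lambda>\<omega>. restrict (\<lambda>k. case_prod X k \<omega>) ({1..n} \<times> {1..}))
      \<in> measurable (offspring_algebra n) (PiM ({1..n} \<times> {1..}) (\<lambda>_. count_space UNIV))"
    unfolding offspring_algebra_def by (rule measurable_vimage_algebra1) (auto simp: space_PiM)
  have "(m, i) \<in> {1..n} \<times> {1..}" using assms by auto
  from measurable_compose[OF Y measurable_component_singleton[OF this]] assms
  show ?thesis by simp
qed

lemma measurable_offspring [measurable]:
  assumes "1 \<le> m" "1 \<le> i"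
  shows "X m i \<in> measurable M (count_space UNIV)"
proof -
  have "\<forall>k\<in>{1..} \<times> {1..}. (\<lambda>(n, i). X n i) k \<in> measurable M (count_space UNIV)"
    using indep_offspring by (auto simp: indep_vars_def)
  from bspec[OF this, of "(m, i)"] show ?thesis using assms by simp
qed

text \<open>Minimality of the generated algebra. Taking \<open>N\<close> to be \<open>M\<close>, or
  the algebra of the next generation, yields the two subalgebra facts.\<close>

lemma sets_offspring_algebra:
  assumes "space N = space M"
    and "\<And>m i. 1 \<le> m \<Longrightarrow> m \<le> n \<Longrightarrow> 1 \<le> i \<Longrightarrow> X m i \<in> measurable N (count_space UNIV)"
  shows "sets (offspring_algebra n) \<subseteq> sets N"
  unfolding offspring_algebra_def using assms
  by (intro sets_image_in_sets measurable_restrict) auto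

lemma subalgebra_offspring_algebra: "subalgebra M (offspring_algebra n)"
  by (auto simp: subalgebra_def dest: sets_offspring_algebra[THEN subsetD, rotated 2])

lemma subalgebra_offspring_algebra_Suc:
  "subalgebra (offspring_algebra (Suc n)) (offspring_algebra n)"
  using sets_offspring_algebra[of "offspring_algebra (Suc n)" n]
  by (simp add: subalgebra_def measurable_offspring_algebra)

lemma measurable_gw_size_offspring_algebra:
  "k \<le> n \<Longrightarrow> gw_size X k \<in> measurable (offspring_algebra n) (count_space UNIV)"
proof (induction k)
  case (Suc k)
  \<comment> \<open>The number of summands is fixed first; the random one takes countably many
    values and is substituted afterwards.\<close>
  have "(\<lambda>\<omega>. \<Sum>i = 1..z. X (Suc k) i \<omega>) \<in> measurable (offspring_algebra n) (count_space UNIV)" for z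
  proof (induction z)
    case (Suc z)
    have "X (Suc k) (Suc z) \<in> measurable (offspring_algebra n) (count_space UNIV)"
      using \<open>Suc k \<le> n\<close> by (intro measurable_offspring_algebra) auto
    then have "(\<lambda>\<omega>. y + X (Suc k) (Suc z) \<omega>) \<in> measurable (offspring_algebra n) (count_space UNIV)"
      for y by (rule measurable_compose) simp
    from measurable_compose_countable[where f="\<lambda>y \<omega>. y + X (Suc k) (Suc z) \<omega>", OF this Suc.IH]
    show ?case by simp
  qed simp
  moreover have "gw_size X k \<in> measurable (offspring_algebra n) (count_space UNIV)"
    using Suc by simp
  ultimately have "(\<lambda>\<omega>. \<Sum>i = 1..gw_size X k \<omega>. X (Suc k) i \<omega>)
      \<in> measurable (offspring_algebra n) (count_space UNIV)"
    by (rule measurable_compose_countable[where f="\<lambda>z \<omega>. \<Sum>i = 1..z. X (Suc k) i \<omega>"])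
  then show ?case by simp
next
  case 0
  have "gw_size X 0 = (\<lambda>_. 1)" by (rule ext) simp
  then show ?case by simp
qed

lemma measurable_gw_size [measurable]: "gw_size X n \<in> measurable M (count_space UNIV)"
  using measurable_from_subalg[OF subalgebra_offspring_algebra measurable_gw_size_offspring_algebra]
  by blast

lemma expectation_power_offspring:
  assumes "1 \<le> n" "1 \<le> i" "0 \<le> s" "s \<le> 1"
  shows "expectation (\<lambda>\<omega>. s ^ X n i \<omega>) = pgf (p n) s"
proof -
  have "expectation (\<lambda>\<omega>. s ^ X n i \<omega>) = (\<integral>j. s ^ j \<partial>distr M (count_space UNIV) (X n i))"
    using assms by (subst integral_distr) auto
  then show ?thesis
    using assms by (simp add: distr_offspring integral_measure_pmf_power)
qed

text \<open>The branching property: given the past, the conditional expectation of \<open>s\<close>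
  to the power of the next size is the offspring generating function to the power of the present
  size. On a level set of the present size the exponent is a fixed sum of offspring variables
  independent of the past. The case \<open>h = 1\<close> iterates the generating functions; general
  \<open>h\<close> gives the martingale.\<close>

lemma expectation_branching:
  assumes h: "h \<in> borel_measurable (offspring_algebra n)"
    and bounded: "\<And>\<omega>. \<omega> \<in> space M \<Longrightarrow> \<bar>h \<omega>\<bar> \<le> K"
    and s: "0 \<le> s" "s \<le> 1"
  shows "expectation (\<lambda>\<omega>. h \<omega> * s ^ gw_size X (Suc n) \<omega>)
    = expectation (\<lambda>\<omega>. h \<omega> * pgf (p (Suc n)) s ^ gw_size X n \<omega>)"
proof (rule integral_eq_if_slices_eq[where N="gw_size X n"])
  have hM[measurable]: "h \<in> borel_measurable M"
    using measurable_from_subalg[OF subalgebra_offspring_algebra h] .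
  have intg: "integrable M (\<lambda>\<omega>. h \<omega> * t ^ gw_size X k \<omega>)" if "0 \<le> t" "t \<le> 1" for t k
  proof (rule integrable_const_bound[where B=K])
    show "AE \<omega> in M. norm (h \<omega> * t ^ gw_size X k \<omega>) \<le> K"
    proof (rule AE_I2)
      fix \<omega> assume "\<omega> \<in> space M"
      have "\<bar>h \<omega>\<bar> * t ^ gw_size X k \<omega> \<le> \<bar>h \<omega>\<bar> * 1"
        using that by (intro mult_left_mono power_le_one) auto
      then show "norm (h \<omega> * t ^ gw_size X k \<omega>) \<le> K"
        using bounded[OF \<open>\<omega> \<in> space M\<close>] that by (simp add: abs_mult)
    qed
  qed measurable
  show "integrable M (\<lambda>\<omega>. h \<omega> * s ^ gw_size X (Suc n) \<omega>)" using s by (rule intg)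
  show "integrable M (\<lambda>\<omega>. h \<omega> * pgf (p (Suc n)) s ^ gw_size X n \<omega>)"
    using s by (intro intg pgf_bounds)
  fix z
  \<comment> \<open>The indicator of the level set belongs to the past as well, so it is absorbed
    into the test function before independence is used.\<close>
  define g where "g \<omega> = indicator {\<omega>. gw_size X n \<omega> = z} \<omega> * h \<omega>" for \<omega>
  have gF: "g \<in> borel_measurable (offspring_algebra n)"
  proof -
    have [measurable]: "gw_size X n \<in> measurable (offspring_algebra n) (count_space UNIV)"
      "h \<in> borel_measurable (offspring_algebra n)"
      using measurable_gw_size_offspring_algebra h by auto
    show ?thesis unfolding g_def by measurable
  qed
  have g_int: "integrable M g"
  proof (rule integrable_const_bound[where B=K])
    show "AE \<omega> in M. norm (g \<omega>) \<le> K"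
      using bounded by (intro AE_I2) (fastforce simp: g_def indicator_def)
    show "g \<in> borel_measurable M"
      using measurable_from_subalg[OF subalgebra_offspring_algebra gF] .
  qed
  let ?I = "{Suc n} \<times> {1..z}"
  have "indep_vars (\<lambda>_. borel) (\<lambda>k \<omega>. s ^ (case k of (n, i) \<Rightarrow> X n i) \<omega>) ?I"
    by (rule indep_vars_compose2[OF indep_vars_subset[OF indep_offspring]]) auto
  then have indep: "indep_vars (\<lambda>_. borel) (\<lambda>k \<omega>. s ^ case_prod X k \<omega>) ?I"
    by simp
  have int_prod: "integrable M (\<lambda>\<omega>. \<Prod>k\<in>?I. s ^ case_prod X k \<omega>)"
    and "expectation (\<lambda>\<omega>. \<Prod>k\<in>?I. s ^ case_prod X k \<omega>) = (\<Prod>k\<in>?I. expectation (\<lambda>\<omega>. s ^ case_prod X k \<omega>))"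
  proof -
    have "integrable M (\<lambda>\<omega>. s ^ case_prod X k \<omega>)" if "k \<in> ?I" for k
      using s that by (intro integrable_const_bound[where B=1]) (auto simp: power_le_one)
    with indep show "integrable M (\<lambda>\<omega>. \<Prod>k\<in>?I. s ^ case_prod X k \<omega>)"
      "expectation (\<lambda>\<omega>. \<Prod>k\<in>?I. s ^ case_prod X k \<omega>) = (\<Prod>k\<in>?I. expectation (\<lambda>\<omega>. s ^ case_prod X k \<omega>))"
      by (intro indep_vars_integrable indep_vars_lebesgue_integral; simp)+
  qed
  note this(2)
  also have "(\<Prod>k\<in>?I. expectation (\<lambda>\<omega>. s ^ case_prod X k \<omega>)) = (\<Prod>k\<in>?I. pgf (p (Suc n)) s)"
    using s by (intro prod.cong refl) (auto simp: expectation_power_offspring)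
  finally have E_prod: "expectation (\<lambda>\<omega>. \<Prod>k\<in>?I. s ^ case_prod X k \<omega>) = pgf (p (Suc n)) s ^ z"
    by (simp add: card_cartesian_product)
  \<comment> \<open>The block \<open>?I\<close> lies in generation \<open>n + 1\<close> and is
    disjoint from the indices generating \<open>offspring_algebra n\<close>. The product is written
    as a function of the restricted family to match \<open>indep_var_vimage_algebra\<close>.\<close>
  have "indep_var borel g borel (\<lambda>\<omega>. (\<lambda>y. \<Prod>k\<in>?I. s ^ y k) (restrict (\<lambda>k. case_prod X k \<omega>) ?I))"
  proof (rule indep_var_vimage_algebra[OF _ gF[unfolded offspring_algebra_def]])
    show "indep_var
        (PiM ({1..n} \<times> {1..}) (\<lambda>_. count_space UNIV)) (\<lambda>\<omega>. restrict (\<lambda>k. case_prod X k \<omega>) ({1..n} \<times> {1..}))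
        (PiM ?I (\<lambda>_. count_space UNIV)) (\<lambda>\<omega>. restrict (\<lambda>k. case_prod X k \<omega>) ?I)"
      by (rule indep_var_restrict) (use indep_offspring in auto)
    show "(\<lambda>y. \<Prod>k\<in>?I. s ^ y k) \<in> borel_measurable (PiM ?I (\<lambda>_. count_space UNIV))"
    proof (rule borel_measurable_prod)
      fix k assume "k \<in> ?I"
      from measurable_component_singleton[OF this]
      show "(\<lambda>y. s ^ y k) \<in> borel_measurable (PiM ?I (\<lambda>_. count_space UNIV))"
        by (rule measurable_compose) simp
    qed
  qed
  then have "indep_var borel g borel (\<lambda>\<omega>. \<Prod>k\<in>?I. s ^ case_prod X k \<omega>)"
    by simp
  from indep_var_lebesgue_integral[OF this g_int int_prod]
  have "expectation (\<lambda>\<omega>. g \<omega> * (\<Prod>k\<in>?I. s ^ case_prod X k \<omega>)) = expectation (\<lambda>\<omega>. g \<omega> * pgf (p (Suc n)) s ^ z)"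
    unfolding E_prod by simp
  moreover have "(\<Prod>k\<in>?I. s ^ case_prod X k \<omega>) = s ^ (\<Sum>i = 1..z. X (Suc n) i \<omega>)" for \<omega>
  proof -
    have "(\<Prod>k\<in>?I. s ^ case_prod X k \<omega>) = s ^ (\<Sum>k\<in>?I. case_prod X k \<omega>)"
      by (simp add: power_sum)
    also have "(\<Sum>k\<in>?I. case_prod X k \<omega>) = (\<Sum>i = 1..z. X (Suc n) i \<omega>)"
      by (rule sum.reindex_bij_witness[of _ "Pair (Suc n)" snd]) auto
    finally show ?thesis .
  qed
  ultimately have "expectation (\<lambda>\<omega>. g \<omega> * s ^ (\<Sum>i = 1..z. X (Suc n) i \<omega>)) = expectation (\<lambda>\<omega>. g \<omega> * pgf (p (Suc n)) s ^ z)"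
    by simp
  also have "(\<lambda>\<omega>. g \<omega> * s ^ (\<Sum>i = 1..z. X (Suc n) i \<omega>))
      = (\<lambda>\<omega>. indicator {\<omega>. gw_size X n \<omega> = z} \<omega> * (h \<omega> * s ^ gw_size X (Suc n) \<omega>))"
    by (auto simp: g_def indicator_def)
  also have "(\<lambda>\<omega>. g \<omega> * pgf (p (Suc n)) s ^ z)
      = (\<lambda>\<omega>. indicator {\<omega>. gw_size X n \<omega> = z} \<omega> * (h \<omega> * pgf (p (Suc n)) s ^ gw_size X n \<omega>))"
    by (auto simp: g_def indicator_def)
  finally show "expectation (\<lambda>\<omega>. indicator {\<omega>. gw_size X n \<omega> = z} \<omega> * (h \<omega> * s ^ gw_size X (Suc n) \<omega>))
      = expectation (\<lambda>\<omega>. indicator {\<omega>. gw_size X n \<omega> = z} \<omega> * (h \<omega> * pgf (p (Suc n)) s ^ gw_size X n \<omega>))" .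
qed measurable

end

section \<open>The limit of the theta-process\<close>

text \<open>In the coordinate \<open>u = (1 - s) powr (-\<theta>)\<close> the generating function is
  the affine map \<open>a * u + c\<close>. The second claim keeps iterates away from the special
  case \<open>s = 1\<close>.\<close>

lemma theta_pgf_complement:
  assumes "0 < \<theta>" "0 < a" "0 \<le> c" "0 \<le> s" "s < 1"
  shows "(1 - theta_pgf \<theta> a c s) powr (-\<theta>) = a * (1 - s) powr (-\<theta>) + c"
    and "theta_pgf \<theta> a c s < 1"
proof -
  have "0 < a * (1 - s) powr (-\<theta>)" using assms by simp
  then have "0 < a * (1 - s) powr (-\<theta>) + c" using assms by linarith
  then show "(1 - theta_pgf \<theta> a c s) powr (-\<theta>) = a * (1 - s) powr (-\<theta>) + c"
    "theta_pgf \<theta> a c s < 1"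
    using assms by (simp_all add: theta_pgf_def powr_powr)
qed

text \<open>Composition of affine maps in that coordinate:
  \<open>A * (a * u + c) + C = (A * a) * u + (C + A * c)\<close>, which is the recursion of
  \<open>env_A\<close> and \<open>env_C\<close>. The point 1 is fixed by both functions.\<close>

lemma theta_pgf_theta_pgf:
  assumes "0 < \<theta>" "0 < a" "0 \<le> c" "0 \<le> s" "s \<le> 1"
  shows "theta_pgf \<theta> A C (theta_pgf \<theta> a c s) = theta_pgf \<theta> (A * a) (C + A * c) s"
proof (cases "s = 1")
  case False
  then have "s < 1" using assms by simp
  with theta_pgf_complement[OF assms(1-4)] show ?thesis
    by (simp add: theta_pgf_def[of \<theta> A C] theta_pgf_def[of \<theta> "A * a"] algebra_simps)
qed (simp add: theta_pgf_def)

lemma env_A_simps [simp]: "env_A a 0 = 1" "env_A a (Suc n) = env_A a n * a (Suc n)"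
  by (simp_all add: env_A_def)

lemma env_C_simps [simp]: "env_C a c 0 = 0" "env_C a c (Suc n) = env_C a c n + env_A a n * c (Suc n)"
  by (simp_all add: env_C_def)

context gw_theta_process
begin

lemma env_A_pos: "0 < env_A a n"
  unfolding env_A_def by (intro prod_pos) (auto intro: a_pos)

text \<open>The branching property peels off the innermost function, that of the last generation.
  The induction hypothesis is then used at a new argument, hence the arbitrary
  \<open>s\<close>.\<close>

lemma expectation_power_gw_size:
  assumes "0 \<le> s" "s \<le> 1"
  shows "expectation (\<lambda>\<omega>. s ^ gw_size X n \<omega>) = theta_pgf \<theta> (env_A a n) (env_C a c n) s"
  using assms
proof (induction n arbitrary: s)
  case 0
  then show ?case using theta_range by (auto simp: prob_space theta_pgf_def powr_powr)
next
  case (Suc n)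
  have "expectation (\<lambda>\<omega>. s ^ gw_size X (Suc n) \<omega>) = expectation (\<lambda>\<omega>. pgf (p (Suc n)) s ^ gw_size X n \<omega>)"
    using expectation_branching[of "\<lambda>_. 1" n 1 s] Suc.prems by simp
  also have "\<dots> = theta_pgf \<theta> (env_A a n) (env_C a c n) (theta_pgf \<theta> (a (Suc n)) (c (Suc n)) s)"
    using Suc.IH[of "pgf (p (Suc n)) s"] Suc.prems pgf_bounds[of s "p (Suc n)"]
    by (simp add: pgf_offspring)
  also have "\<dots> = theta_pgf \<theta> (env_A a (Suc n)) (env_C a c (Suc n)) s"
    using theta_pgf_theta_pgf theta_range a_pos[of "Suc n"] c_pos[of "Suc n"] Suc.prems by simp
  finally show ?case .
qed

lemma incseq_env_C: "incseq (env_C a c)"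
proof (rule incseq_SucI)
  fix n
  have "0 \<le> env_A a n * c (Suc n)"
    using env_A_pos[of n] c_pos[of "Suc n"] by (intro mult_nonneg_nonneg) auto
  then show "env_C a c n \<le> env_C a c (Suc n)" by simp
qed

text \<open>This is where \<open>c_ge\<close> enters. In the limit it bounds
  \<open>A_n + C_n\<close> by \<open>C\<close>, which makes \<open>C\<close> positive and later
  keeps \<open>backward_arg\<close> positive.\<close>

lemma incseq_env_A_plus_env_C: "incseq (\<lambda>n. env_A a n + env_C a c n)"
proof (rule incseq_SucI)
  fix n
  have "env_A a n * 1 \<le> env_A a n * (a (Suc n) + c (Suc n))"
    using env_A_pos[of n] c_ge[of "Suc n"] by (intro mult_left_mono) auto
  then show "env_A a n + env_C a c n \<le> env_A a (Suc n) + env_C a c (Suc n)"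
    by (simp add: algebra_simps)
qed

end

section \<open>Convergent \<open>env_C\<close> and vanishing \<open>env_A\<close>\<close>

locale gw_theta_limit = gw_theta_process +
  fixes C :: real
  assumes lim_C: "env_C a c \<longlonglongrightarrow> C" and lim_A: "env_A a \<longlonglongrightarrow> 0"
begin

lemma env_C_le: "env_C a c n \<le> C"
  using incseq_le[OF incseq_env_C lim_C] .

lemma env_A_plus_env_C_le: "env_A a n + env_C a c n \<le> C"
proof -
  have "(\<lambda>n. env_A a n + env_C a c n) \<longlonglongrightarrow> 0 + C"
    by (intro tendsto_add lim_A lim_C)
  from incseq_le[OF incseq_env_A_plus_env_C this] show ?thesis by simp
qed

lemma C_pos: "0 < C"
  using env_A_plus_env_C_le[of 0] by simp

definition norming :: "nat \<Rightarrow> real" where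
  "norming n = env_A a n powr (1 / \<theta>)"

lemma norming_pos: "0 < norming n"
  using env_A_pos[of n] by (simp add: norming_def)

lemma norming_powr: "norming n powr (-\<theta>) = inverse (env_A a n)"
  using env_A_pos[of n] theta_range by (simp add: norming_def powr_powr powr_minus)

lemma tendsto_norming: "norming \<longlonglongrightarrow> 0"
proof -
  have "(\<lambda>n. env_A a n powr (1 / \<theta>)) \<longlonglongrightarrow> 0 powr (1 / \<theta>)"
    \<comment> \<open>The base tends to 0, where \<open>powr\<close> is continuous only for a
      positive exponent and nonnegative bases.\<close>
    using env_A_pos theta_range by (intro tendsto_powr' lim_A tendsto_const) (auto intro: less_imp_le always_eventually)
  then show ?thesis by (simp add: norming_def[abs_def])
qed

lemma extinction_probability:
  "(\<lambda>n. prob {\<omega> \<in> space M. gw_size X n \<omega> = 0}) \<longlonglongrightarrow> 1 - C powr (-1 / \<theta>)"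
proof -
  have "prob {\<omega> \<in> space M. gw_size X n \<omega> = 0} = 1 - (env_A a n + env_C a c n) powr (-1 / \<theta>)" for n
  proof -
    have "prob {\<omega> \<in> space M. gw_size X n \<omega> = 0} = expectation (indicator {\<omega> \<in> space M. gw_size X n \<omega> = 0})"
      by (simp add: Int_def conj_commute)
    \<comment> \<open>As \<open>0 ^ 0 = 1\<close>, the power of 0 is the indicator of
      extinction.\<close>
    also have "\<dots> = expectation (\<lambda>\<omega>. 0 ^ gw_size X n \<omega>)"
      by (intro Bochner_Integration.integral_cong refl) (auto simp: indicator_def power_0_left)
    also have "\<dots> = 1 - (env_A a n + env_C a c n) powr (-1 / \<theta>)"
      using expectation_power_gw_size[of 0 n] by (simp add: theta_pgf_def)
    finally show ?thesis .
  qed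
  moreover have "(\<lambda>n. 1 - (env_A a n + env_C a c n) powr (-1 / \<theta>)) \<longlonglongrightarrow> 1 - (0 + C) powr (-1 / \<theta>)"
    using C_pos by (intro tendsto_intros lim_A lim_C) auto
  ultimately show ?thesis by simp
qed

lemma tendsto_laplace_transform:
  assumes l: "0 < l"
  shows "(\<lambda>n. expectation (\<lambda>\<omega>. exp (- l * (norming n * real (gw_size X n \<omega>)))))
    \<longlonglongrightarrow> 1 - (l powr (-\<theta>) + C) powr (-1 / \<theta>)"
proof -
  let ?g = "\<lambda>x::real. (1 - exp (- l * x)) / x"
  have eq: "expectation (\<lambda>\<omega>. exp (- l * (norming n * real (gw_size X n \<omega>))))
      = 1 - (?g (norming n) powr (-\<theta>) + env_C a c n) powr (-1 / \<theta>)" for n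
  proof -
    define s where "s = exp (- l * norming n)"
    have s: "0 < s" "s < 1" using l norming_pos[of n] by (simp_all add: s_def)
    have "expectation (\<lambda>\<omega>. exp (- l * (norming n * real (gw_size X n \<omega>)))) = expectation (\<lambda>\<omega>. s ^ gw_size X n \<omega>)"
      by (simp add: s_def exp_of_nat_mult[symmetric] mult_ac)
    also have "\<dots> = 1 - (env_A a n * (1 - s) powr (-\<theta>) + env_C a c n) powr (-1 / \<theta>)"
      using expectation_power_gw_size[of s n] s by (simp add: theta_pgf_def)
    also have "env_A a n * (1 - s) powr (-\<theta>) = ((1 - s) / norming n) powr (-\<theta>)"
      \<comment> \<open>\<open>norming n powr (-\<theta>)\<close> is the inverse of
        \<open>env_A a n\<close>, so the factor \<open>env_A a n\<close> moves inside the power as a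
        division by \<open>norming n\<close>.\<close>
      using s norming_pos[of n] by (simp add: powr_divide norming_powr) (simp add: divide_inverse)
    finally show ?thesis by (simp add: s_def)
  qed
  \<comment> \<open>\<open>?g\<close> is the difference quotient at 0 of
    \<open>1 - exp (- l * x)\<close>, whose derivative there is \<open>l\<close>.\<close>
  have "(?g \<longlongrightarrow> l) (at 0)"
  proof -
    have "((\<lambda>x. 1 - exp (- l * x)) has_real_derivative l) (at 0)"
      by (auto intro!: derivative_eq_intros)
    then show ?thesis by (simp add: has_field_derivative_iff)
  qed
  moreover have "filterlim norming (at 0) sequentially"
    using tendsto_norming norming_pos by (auto simp: filterlim_at intro!: always_eventually less_imp_neq[symmetric])
  ultimately have "(\<lambda>n. ?g (norming n)) \<longlonglongrightarrow> l"
    by (rule filterlim_compose)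
  moreover have "l powr (-\<theta>) + C \<noteq> 0"
    using C_pos by (smt (verit) powr_ge_zero)
  ultimately have "(\<lambda>n. 1 - (?g (norming n) powr (-\<theta>) + env_C a c n) powr (-1 / \<theta>))
      \<longlonglongrightarrow> 1 - (l powr (-\<theta>) + C) powr (-1 / \<theta>)"
    using l by (intro tendsto_intros lim_C) auto
  then show ?thesis unfolding eq .
qed

text \<open>Arguments \<open>s\<^sub>n\<close> with \<open>f\<^sub>n(s\<^sub>n) = s\<^sub>n\<^sub>-\<^sub>1\<close> are those for which
  \<open>A\<^sub>n (1 - s\<^sub>n) powr (-\<theta>) + C\<^sub>n\<close> does not depend on \<open>n\<close>; the value \<open>1 + C\<close> of this
  constant makes \<open>1 - s\<^sub>n\<close> asymptotic to \<open>A\<^sub>n powr (1 / \<theta>)\<close>.\<close>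

definition backward_arg :: "nat \<Rightarrow> real" where
  "backward_arg n = 1 - norming n * (1 + C - env_C a c n) powr (-1 / \<theta>)"

lemma backward_arg_complement_powr:
  "(1 - backward_arg n) powr (-\<theta>) = (1 + C - env_C a c n) / env_A a n"
proof -
  have "0 < 1 + C - env_C a c n" using env_C_le[of n] by simp
  then show ?thesis
    using norming_pos[of n] theta_range
    by (simp add: backward_arg_def powr_mult powr_powr norming_powr divide_simps)
qed

lemma backward_arg_bounds: "0 < backward_arg n" "backward_arg n < 1"
proof -
  have pos: "0 < 1 + C - env_C a c n" using env_C_le[of n] by simp
  then show "backward_arg n < 1" using norming_pos[of n] by (simp add: backward_arg_def)
  \<comment> \<open>The summand 1 in \<open>1 + C\<close> makes the inequality strict. Then
    \<open>(1 - backward_arg n) powr (-\<theta>)\<close> exceeds 1, and a negative exponent reverses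
    the order.\<close>
  have "env_A a n < 1 + C - env_C a c n"
    using env_A_plus_env_C_le[of n] by simp
  then have "1 powr (-\<theta>) < (1 - backward_arg n) powr (-\<theta>)"
    using env_A_pos[of n] by (simp add: backward_arg_complement_powr)
  then show "0 < backward_arg n"
    using powr_mono2'[of "-\<theta>" 1 "1 - backward_arg n"] theta_range by (cases "backward_arg n \<le> 0") auto
qed

text \<open>In the affine coordinate, \<open>a (Suc n)\<close> cancels against
  \<open>env_A a (Suc n)\<close>, and \<open>c (Suc n)\<close> adds
  \<open>env_A a n * c (Suc n)\<close> to the numerator, which turns
  \<open>env_C a c (Suc n)\<close> back into \<open>env_C a c n\<close>.\<close>

lemma pgf_backward_arg: "pgf (p (Suc n)) (backward_arg (Suc n)) = backward_arg n"
proof -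
  have "a (Suc n) * (1 - backward_arg (Suc n)) powr (-\<theta>) + c (Suc n) = (1 - backward_arg n) powr (-\<theta>)"
    unfolding backward_arg_complement_powr
    using a_pos[of "Suc n"] env_A_pos[of n] by (simp add: field_simps)
  then show ?thesis
    using backward_arg_bounds[of n] backward_arg_bounds[of "Suc n"] theta_range
    by (simp add: pgf_offspring theta_pgf_def powr_powr)
qed

section \<open>The martingale and its logarithm\<close>

definition V :: "nat \<Rightarrow> 'a \<Rightarrow> real" where
  "V n \<omega> = backward_arg n ^ gw_size X n \<omega>"

lemma V_bounds: "0 < V n \<omega>" "V n \<omega> \<le> 1"
  using backward_arg_bounds[of n] by (simp_all add: V_def power_le_one)

lemma measurable_V [measurable]: "V n \<in> borel_measurable M"
  unfolding V_def[abs_def] by measurable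

text \<open>The branching property at \<open>backward_arg (Suc n)\<close> is the martingale
  identity, since the generating function maps this argument to
  \<open>backward_arg n\<close>.\<close>

lemma AE_convergent_V: "AE \<omega> in M. convergent (\<lambda>n. V n \<omega>)"
proof (rule bounded_martingale_AE_convergent[where F=offspring_algebra and B=1])
  show "V n \<in> borel_measurable (offspring_algebra n)" for n
    unfolding V_def[abs_def] using measurable_gw_size_offspring_algebra[of n n, OF order_refl]
    by (rule measurable_compose) simp
  show "\<bar>V n \<omega>\<bar> \<le> 1" for n \<omega>
    using V_bounds[of n \<omega>] by simp
  fix n and h :: "'a \<Rightarrow> real"
  assume h: "h \<in> borel_measurable (offspring_algebra n)" "\<exists>K. \<forall>\<omega>\<in>space M. \<bar>h \<omega>\<bar> \<le> K"
  then obtain K where "\<And>\<omega>. \<omega> \<in> space M \<Longrightarrow> \<bar>h \<omega>\<bar> \<le> K" by blast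
  from expectation_branching[OF h(1) this, of "backward_arg (Suc n)"] backward_arg_bounds[of "Suc n"]
  show "expectation (\<lambda>\<omega>. h \<omega> * V (Suc n) \<omega>) = expectation (\<lambda>\<omega>. h \<omega> * V n \<omega>)"
    by (simp add: V_def pgf_backward_arg)
qed (rule subalgebra_offspring_algebra subalgebra_offspring_algebra_Suc)+

text \<open>The factor between minus the logarithm of \<open>V n\<close> and the normed size. Its
  limit 1 makes the two asymptotically equal.\<close>

definition rate :: "nat \<Rightarrow> real" where
  "rate n = - ln (backward_arg n) / norming n"

lemma rate_pos: "0 < rate n"
  using backward_arg_bounds[of n] norming_pos[of n] by (simp add: rate_def divide_neg_pos)

lemma ln_V: "ln (V n \<omega>) = - rate n * (norming n * real (gw_size X n \<omega>))"
  using backward_arg_bounds[of n] norming_pos[of n] by (simp add: V_def rate_def ln_realpow)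

lemma tendsto_rate: "rate \<longlonglongrightarrow> 1"
proof -
  \<comment> \<open>\<open>1 - backward_arg n = norming n * b n\<close>, and \<open>b\<close> tends
    to 1 because \<open>1 + C - env_C a c n\<close> does. The rest is the derivative of
    \<open>- ln (1 - x)\<close> at 0.\<close>
  define b where "b n = (1 + C - env_C a c n) powr (-1 / \<theta>)" for n
  have "b \<longlonglongrightarrow> (1 + C - C) powr (-1 / \<theta>)"
    unfolding b_def[abs_def] by (intro tendsto_intros lim_C) auto
  then have b: "b \<longlonglongrightarrow> 1" by simp
  have b_pos: "0 < b n" for n using env_C_le[of n] by (simp add: b_def)
  have lim: "(\<lambda>n. norming n * b n) \<longlonglongrightarrow> 0 * 1"
    by (intro tendsto_mult b tendsto_norming)
  have "((\<lambda>x::real. - ln (1 - x) / x) \<longlongrightarrow> 1) (at 0)"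
  proof -
    have "((\<lambda>x::real. - ln (1 - x)) has_real_derivative 1) (at 0)"
      by (auto intro!: derivative_eq_intros)
    then show ?thesis by (simp add: has_field_derivative_iff)
  qed
  moreover have "filterlim (\<lambda>n. norming n * b n) (at 0) sequentially"
    using lim norming_pos b_pos
    by (auto simp: filterlim_at intro!: always_eventually) (metis less_irrefl)+
  ultimately have "(\<lambda>n. - ln (1 - norming n * b n) / (norming n * b n)) \<longlonglongrightarrow> 1"
    by (rule filterlim_compose)
  then have "(\<lambda>n. - ln (1 - norming n * b n) / (norming n * b n) * b n) \<longlonglongrightarrow> 1 * 1"
    by (intro tendsto_mult b)
  moreover have "- ln (1 - norming n * b n) / (norming n * b n) * b n = rate n" for n
    using b_pos[of n] by (simp add: rate_def backward_arg_def b_def)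
  ultimately show ?thesis by simp
qed

section \<open>The limit of the martingale and its Laplace transform\<close>

text \<open>\<open>lim\<close> is total, which gives a function on the whole space; it is known to
  be the limit only on the almost sure event of convergence.\<close>

definition V_lim :: "'a \<Rightarrow> real" where
  "V_lim \<omega> = lim (\<lambda>n. V n \<omega>)"

lemma measurable_V_lim [measurable]: "V_lim \<in> borel_measurable M"
  unfolding V_lim_def[abs_def] by measurable

lemma AE_tendsto_V: "AE \<omega> in M. (\<lambda>n. V n \<omega>) \<longlonglongrightarrow> V_lim \<omega> \<and> 0 \<le> V_lim \<omega> \<and> V_lim \<omega> \<le> 1"
  using AE_convergent_V
proof eventually_elim
  case (elim \<omega>)
  then have "(\<lambda>n. V n \<omega>) \<longlonglongrightarrow> V_lim \<omega>"
    by (simp add: V_lim_def convergent_LIMSEQ_iff)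
  moreover from this have "0 \<le> V_lim \<omega>"
    using V_bounds(1) by (intro LIMSEQ_le_const) (auto intro: less_imp_le)
  moreover from calculation(1) have "V_lim \<omega> \<le> 1"
    using V_bounds(2) by (intro LIMSEQ_le_const2) auto
  ultimately show ?case by blast
qed

text \<open>\<open>V n\<close> to the power \<open>l / rate n\<close> is exactly the exponential of
  the normed size, so bounded convergence applies. At this stage \<open>V_lim\<close> may still
  vanish; \<open>powr\<close> with a positive exponent is continuous at 0, whereas the logarithm is
  not.\<close>

lemma expectation_V_lim_powr:
  assumes l: "0 < l"
  shows "expectation (\<lambda>\<omega>. V_lim \<omega> powr l) = 1 - (l powr (-\<theta>) + C) powr (-1 / \<theta>)"
proof (rule LIMSEQ_unique[OF _ tendsto_laplace_transform[OF l]])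
  show "(\<lambda>n. expectation (\<lambda>\<omega>. exp (- l * (norming n * real (gw_size X n \<omega>)))))
      \<longlonglongrightarrow> expectation (\<lambda>\<omega>. V_lim \<omega> powr l)"
  proof (rule integral_dominated_convergence[where w="\<lambda>_. 1"])
    show "AE \<omega> in M. (\<lambda>n. exp (- l * (norming n * real (gw_size X n \<omega>)))) \<longlonglongrightarrow> V_lim \<omega> powr l"
      using AE_tendsto_V
    proof eventually_elim
      case (elim \<omega>)
      have "(\<lambda>n. V n \<omega> powr (l / rate n)) \<longlonglongrightarrow> V_lim \<omega> powr (l / 1)"
        using elim V_bounds(1) l tendsto_rate
        by (intro tendsto_powr' tendsto_intros) (auto intro: less_imp_le always_eventually)
      moreover have "V n \<omega> powr (l / rate n) = exp (- l * (norming n * real (gw_size X n \<omega>)))" for n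
        using V_bounds(1)[of n \<omega>] rate_pos[of n] by (simp add: powr_def ln_V)
      ultimately show ?case by simp
    qed
    show "AE \<omega> in M. norm (exp (- l * (norming n * real (gw_size X n \<omega>)))) \<le> 1" for n
      using l norming_pos[of n] by (intro AE_I2) (simp add: less_imp_le)
  qed measurable
qed

text \<open>As the exponent decreases to 0, the powers of \<open>V_lim\<close> tend to the indicator
  of its positivity, while their expectations tend to 1. This excludes an infinite limit of the
  normed sizes.\<close>

lemma AE_V_lim_pos: "AE \<omega> in M. 0 < V_lim \<omega>"
proof -
  let ?l = "\<lambda>k. inverse (real (Suc k))"
  have l0: "?l \<longlonglongrightarrow> 0" by (rule LIMSEQ_inverse_real_of_nat)
  have "(\<lambda>k. expectation (\<lambda>\<omega>. V_lim \<omega> powr ?l k)) \<longlonglongrightarrow> expectation (indicator {\<omega> \<in> space M. 0 < V_lim \<omega>})"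
  proof (rule integral_dominated_convergence[where w="\<lambda>_. 1"])
    show "AE \<omega> in M. (\<lambda>k. V_lim \<omega> powr ?l k) \<longlonglongrightarrow> indicator {\<omega> \<in> space M. 0 < V_lim \<omega>} \<omega>"
      using AE_tendsto_V AE_space
    proof eventually_elim
      case (elim \<omega>)
      show ?case
      \<comment> \<open>At 0 all the powers are 0, in agreement with the indicator; elsewhere they
        tend to \<open>V_lim \<omega> powr 0 = 1\<close>.\<close>
      proof (cases "V_lim \<omega> = 0")
        case False
        then have "(\<lambda>k. V_lim \<omega> powr ?l k) \<longlonglongrightarrow> V_lim \<omega> powr 0"
          by (intro tendsto_powr tendsto_const l0)
        then show ?thesis using elim False by simp
      qed simp
    qed
    show "AE \<omega> in M. norm (V_lim \<omega> powr ?l k) \<le> 1" for k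
      using AE_tendsto_V by eventually_elim (simp add: powr_le1)
  qed measurable
  moreover have "(\<lambda>k. expectation (\<lambda>\<omega>. V_lim \<omega> powr ?l k)) \<longlonglongrightarrow> 1"
  proof -
    have "((\<lambda>l. 1 - (l powr (-\<theta>) + C) powr (-1 / \<theta>)) \<longlongrightarrow> 1) (at_right 0)"
      using theta_range C_pos by real_asymp
    moreover have "filterlim ?l (at_right 0) sequentially"
      using l0 by (auto simp: filterlim_at)
    ultimately have "(\<lambda>k. 1 - (?l k powr (-\<theta>) + C) powr (-1 / \<theta>)) \<longlonglongrightarrow> 1"
      by (rule filterlim_compose)
    then show ?thesis by (simp add: expectation_V_lim_powr)
  qed
  ultimately have "expectation (indicator {\<omega> \<in> space M. 0 < V_lim \<omega>}) = (1::real)"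
    by (rule LIMSEQ_unique)
  then have "prob {\<omega> \<in> space M. 0 < V_lim \<omega>} = 1" by (simp add: Int_def conj_commute)
  then have "AE \<omega> in M. \<omega> \<in> {\<omega> \<in> space M. 0 < V_lim \<omega>}"
    by (subst AE_in_set_eq_1) auto
  then show ?thesis by eventually_elim simp
qed

text \<open>Where \<open>V_lim\<close> is not positive the value is a convention of
  \<open>ln\<close>; this happens only on a null set.\<close>

definition W :: "'a \<Rightarrow> real" where
  "W \<omega> = - ln (V_lim \<omega>)"

lemma measurable_W [measurable]: "W \<in> borel_measurable M"
  unfolding W_def[abs_def] by measurable

lemma AE_tendsto_W: "AE \<omega> in M. (\<lambda>n. norming n * real (gw_size X n \<omega>)) \<longlonglongrightarrow> W \<omega>"
  using AE_tendsto_V AE_V_lim_pos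
proof eventually_elim
  case (elim \<omega>)
  then have "(\<lambda>n. - ln (V n \<omega>) / rate n) \<longlonglongrightarrow> - ln (V_lim \<omega>) / 1"
    by (intro tendsto_intros tendsto_rate) auto
  moreover have "- ln (V n \<omega>) / rate n = norming n * real (gw_size X n \<omega>)" for n
    using rate_pos[of n] by (simp add: ln_V)
  ultimately show ?case by (simp add: W_def)
qed

lemma laplace_transform_W:
  assumes "0 < l"
  shows "expectation (\<lambda>\<omega>. exp (- l * W \<omega>)) = 1 - (l powr (-\<theta>) + C) powr (-1 / \<theta>)"
proof -
  have "AE \<omega> in M. exp (- l * W \<omega>) = V_lim \<omega> powr l"
    using AE_V_lim_pos by eventually_elim (simp add: W_def powr_def)
  then have "expectation (\<lambda>\<omega>. exp (- l * W \<omega>)) = expectation (\<lambda>\<omega>. V_lim \<omega> powr l)"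
    by (intro integral_cong_AE) auto
  then show ?thesis using expectation_V_lim_powr[OF assms] by simp
qed

end

theorem theorem1:
  fixes M :: "'a measure"
    and X :: "nat \<Rightarrow> nat \<Rightarrow> 'a \<Rightarrow> nat"
    and p :: "nat \<Rightarrow> nat pmf"
    and \<theta> C :: real
    and a c :: "nat \<Rightarrow> real"
  assumes "gw_theta_process M X p \<theta> a c"
    and "env_C a c \<longlonglongrightarrow> C"
    and "env_A a \<longlonglongrightarrow> 0"
  shows "(\<lambda>n. measure M {\<omega> \<in> space M. gw_size X n \<omega> = 0}) \<longlonglongrightarrow> 1 - C powr (-1 / \<theta>)
    \<and> (\<exists>W :: 'a \<Rightarrow> real. W \<in> borel_measurable M
        \<and> (AE \<omega> in M. (\<lambda>n. env_A a n powr (1 / \<theta>) * real (gw_size X n \<omega>)) \<longlonglongrightarrow> W \<omega>)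
        \<and> (\<forall>l\<ge>0. (\<integral>\<omega>. exp (- l * W \<omega>) \<partial>M) =
              (if l = 0 then 1 else 1 - (l powr (-\<theta>) + C) powr (-1 / \<theta>))))"
proof -
  interpret gw_theta_limit M X p \<theta> a c C
    using assms by (simp add: gw_theta_limit_def gw_theta_limit_axioms_def)
  \<comment> \<open>At \<open>l = 0\<close> the integrand is 1. The closed formula must be avoided
    there, because \<open>0 powr (-\<theta>) = 0\<close> where infinity is meant.\<close>
  have "expectation (\<lambda>\<omega>. exp (- l * W \<omega>)) =
      (if l = 0 then 1 else 1 - (l powr (-\<theta>) + C) powr (-1 / \<theta>))" if "0 \<le> l" for l
    using laplace_transform_W[of l] that by (cases "l = 0") (auto simp: prob_space)
  then show ?thesis
    using extinction_probability AE_tendsto_W measurable_W unfolding norming_def by blast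
qed

end
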